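(* Let $n=5$, fix pairwise distinct $i,j,k\in\{1,2,3\}$, and let $\boldsymbol{D}$ be a channel matrix of monomials. Consider offsets $p$ satisfying the alignment equations (A1)–(A8). Then: (1) Such offsets $p$ satisfying (A1)–(A8) together with all separability conditions (S1)–(S3) except the two inter-user collisions forced by (A5) and (A8) exist if $\boldsymbol{D}$ satisfies conditions (i)–(x) below; conversely, if such offsets exist then $\boldsymbol{D}$ satisfies (i)–(x). (2) Under (i)–(x), if the message $W_{jk}$ is delivered from $\mathrm{Tx}_k$ to $\mathrm{Rx}_j$ over a single interference-free feedforward backhaul link of rate $1$ (one message), and $\mathrm{Tx}_k$ does not transmit $W_{jk}$ over the channel, then every one of the $9$ messages is obtained by its intended receiver within $n=5$ dimensions, i.e. $\frac{9}{5}$ degrees of freedom are achieved with feedforward sum-rate $\Theta_{\mathrm{FF}}=1$. (3) Feedforward sum-rate $\Theta_{\mathrm{FF}}\ge 1$ is necessary to achieve $\frac{9}{5}$ degrees of freedom with $n=5$. Conditions (all congruences mod $x^5-1$): (i) $d_{ij}d_{ki}d_{jk}\equiv d_{ji}d_{ik}d_{kj}$; (ii) $d_{ii}d_{jk}d_{kj}\equiv d_{jj}d_{ik}d_{ki}\equiv d_{kk}d_{ij}d_{ji}$; (iii) $d_{ii}d_{kk}\not\equiv d_{ik}d_{ki}$; (iv) $d_{ii}d_{jj}\not\equiv d_{ij}d_{ji}$; (v) $d_{ii}d_{jk}\not\equiv d_{ik}d_{ji}$; (vi) $d_{ij}d_{jk}\not\equiv d_{ik}d_{jj}$; (vii) $d_{kk}d_{ji}\not\equiv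 d_{ki}d_{jk}$; (viii) $d_{kk}d_{jj}\not\equiv d_{kj}d_{jk}$; (ix) $d_{ii}d_{jj}d_{kk}\not\equiv d_{ij}d_{jk}d_{ki}$ (and $d_{ij}d_{jk}d_{ki}\equiv d_{ji}d_{kj}d_{ik}$); (x) $d_{kk}d_{ii}d_{jj}d_{kk}\not\equiv d_{jk}d_{kj}d_{ik}d_{ki}$, $d_{ii}d_{ii}d_{jj}d_{kk}\not\equiv d_{ij}d_{ji}d_{ik}d_{ki}$, $d_{jj}d_{ii}d_{jj}d_{kk}\not\equiv d_{ij}d_{ji}d_{jk}d_{kj}$.
   Context: Cyclic polynomial channel model of the $3$-user $X$-network. Fix $n\in\mathbb{N}$; all congruences are taken in the polynomial ring modulo $x^n-1$, so $x^a\equiv x^b$ iff $a\equiv b \pmod n$. Let $\mathcal{K}=\{1,2,3\}$. Transmitter $\mathrm{Tx}_i$ holds one message $W_{ji}$ for each receiver $\mathrm{Rx}_j$ ($9$ messages), each an element of an abelian group (binary strings of length $t$). $\mathrm{Tx}_i$ chooses offsets $p_{ji}\in\{0,\dots,n-1\}$ and transmits $u_i(x)\equiv\sum_{j}W_{ji}x^{p_{ji}}$. The channel matrix $\boldsymbol{D}=(d_{ji})$ has each $d_{ji}$ a monomial $x^k$, $k\in\mathbb{N}$, known to all. $\mathrm{Rx}_j$ observes $r_j(x)\equiv\sum_i d_{ji}u_i(x)$, whose coefficient at $x^m$ is the sum of all messages arriving at offset $m$. At $\mathrm{Rx}_a$ the dedicated signals are $d_{al}x^{p_{al}}$ ($l\in\mathcal{K}$)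 and the interfering signals are $d_{al}x^{p_{bl}}$ with $b\neq a$. Separability conditions: (S1) for each $i$, $x^{p_{1i}},x^{p_{2i}},x^{p_{3i}}$ pairwise incongruent; (S2) for each $a$, the three dedicated signals at $\mathrm{Rx}_a$ pairwise incongruent; (S3) for each $a$, every dedicated signal at $\mathrm{Rx}_a$ incongruent to every interfering signal at $\mathrm{Rx}_a$. A message is received interference-free if it occupies an offset at its intended receiver containing no other message; degrees of freedom $=M/n$ with $M$ the number of messages obtained by their intended receivers. A feedforward backhaul link from $\mathrm{Tx}_i$ to $\mathrm{Rx}_j$ of rate $1$ delivers one message $W_{ji}$ interference-free; $\Theta_{\mathrm{FF}}$ is the total number of messages sent over such links. Alignment scheme for fixed pairwise distinct $i,j,k$: (A1) $d_{ii}x^{p_{ji}}\equiv d_{ij}x^{p_{kj}}\equiv d_{ik}x^{p_{jk}}$; (A2) $d_{ii}x^{p_{ki}}\equiv d_{ij}x^{p_{jj}}\equiv d_{ik}x^{p_{kk}}$; (A3) $d_{ji}x^{p_{ki}}\equiv d_{jj}x^{p_{kj}}\equiv d_{jk}x^{p_{ik}}$; (A4) $d_{ji}x^{p_{ii}}\equiv d_{jk}x^{p_{kk}}$; (A5) $d_{jj}x^{p_{ij}}\equiv d_{jk}x^{p_{jk}}$; (A6) $d_{ki}x^{p_{ii}}\equiv d_{kj}x^{p_{jj}}\equiv d_{kk}x^{p_{ik}}$; (A7) $d_{kj}x^{p_{ij}}\equiv d_{ki}x^{p_{ji}}$; (A8) $d_{ki}x^{p_{ki}}\equiv d_{kk}x^{p_{jk}}$.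 (A5) violates (S3) at $\mathrm{Rx}_j$ (dedicated $W_{jk}$ collides with interfering $W_{ij}$), and (A8) violates (S3) at $\mathrm{Rx}_k$ (dedicated $W_{ki}$ collides with interfering $W_{jk}$); these two collisions are the exempted ones. *)

theory Defs
  imports "HOL-Number_Theory.Cong" Complex_Main
begin

text \<open>
Cyclic polynomial channel model of the 3-user X-network.
Users/indices are the naturals 1, 2, 3.  Every channel coefficient d_{al}
(from Tx_l to Rx_a) is a monomial x^(D a l); we store the exponent D a l :: nat.
Every message W_{bl} (held by Tx_l, intended for Rx_b) is sent at offset
x^(p b l); we store p b l :: nat.  Since all congruences are modulo x^n - 1 and
x^a \<equiv> x^b iff a \<equiv> b (mod n), a congruence between products of monomials
is a congruence (mod n) between the sums of their exponents.
The signal of W_{bl} at Rx_a is d_{al} x^(p b l) = x^(D a l + p b l).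
\<close>

definition Users :: "nat set" where
  "Users = {1, 2, 3}"

type_synonym channel = "nat \<Rightarrow> nat \<Rightarrow> nat"  \<comment> \<open>D a l : exponent of d_{al}\<close>
type_synonym offsets = "nat \<Rightarrow> nat \<Rightarrow> nat"  \<comment> \<open>p b l : offset of W_{bl} at Tx_l\<close>

definition sig :: "channel \<Rightarrow> offsets \<Rightarrow> nat \<Rightarrow> nat \<Rightarrow> nat \<Rightarrow> nat" where
  "sig D p a l b = D a l + p b l"

definition offsets_ok :: "nat \<Rightarrow> offsets \<Rightarrow> bool" where
  "offsets_ok n p \<longleftrightarrow> (\<forall>b\<in>Users. \<forall>l\<in>Users. p b l < n)"

definition alignment :: "nat \<Rightarrow> channel \<Rightarrow> nat \<Rightarrow> nat \<Rightarrow> nat \<Rightarrow> offsets \<Rightarrow> bool" where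
  "alignment n D i j k p \<longleftrightarrow>
     \<comment> \<open>(A1)\<close>
     [sig D p i i j = sig D p i j k] (mod n) \<and> [sig D p i j k = sig D p i k j] (mod n) \<and>
     \<comment> \<open>(A2)\<close>
     [sig D p i i k = sig D p i j j] (mod n) \<and> [sig D p i j j = sig D p i k k] (mod n) \<and>
     \<comment> \<open>(A3)\<close>
     [sig D p j i k = sig D p j j k] (mod n) \<and> [sig D p j j k = sig D p j k i] (mod n) \<and>
     \<comment> \<open>(A4)\<close>
     [sig D p j i i = sig D p j k k] (mod n) \<and>
     \<comment> \<open>(A5)\<close>
     [sig D p j j i = sig D p j k j] (mod n) \<and>
     \<comment> \<open>(A6)\<close>
     [sig D p k i i = sig D p k j j] (mod n) \<and> [sig D p k j j = sig D p k k i] (mod n) \<and>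
     \<comment> \<open>(A7)\<close>
     [sig D p k j i = sig D p k i j] (mod n) \<and>
     \<comment> \<open>(A8)\<close>
     [sig D p k i k = sig D p k k j] (mod n)"

definition sep_S1 :: "nat \<Rightarrow> offsets \<Rightarrow> bool" where
  "sep_S1 n p \<longleftrightarrow> (\<forall>l\<in>Users. \<forall>a\<in>Users. \<forall>b\<in>Users. a \<noteq> b \<longrightarrow> \<not> [p a l = p b l] (mod n))"

definition sep_S2 :: "nat \<Rightarrow> channel \<Rightarrow> offsets \<Rightarrow> bool" where
  "sep_S2 n D p \<longleftrightarrow> (\<forall>a\<in>Users. \<forall>l\<in>Users. \<forall>l'\<in>Users.
      l \<noteq> l' \<longrightarrow> \<not> [sig D p a l a = sig D p a l' a] (mod n))"

text \<open>(S3) with a set E of exempted collisions: a tuple (a, l, b, l') in E means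
  that the collision at Rx_a of the dedicated W_{al} with the interfering W_{bl'}
  is exempted.\<close>
definition sep_S3_except :: "nat \<Rightarrow> channel \<Rightarrow> offsets \<Rightarrow> (nat \<times> nat \<times> nat \<times> nat) set \<Rightarrow> bool" where
  "sep_S3_except n D p E \<longleftrightarrow> (\<forall>a\<in>Users. \<forall>l\<in>Users. \<forall>b\<in>Users. \<forall>l'\<in>Users.
      b \<noteq> a \<longrightarrow> (a, l, b, l') \<notin> E \<longrightarrow> \<not> [sig D p a l a = sig D p a l' b] (mod n))"

text \<open>The two exempted collisions: (A5) at Rx_j (dedicated W_{jk} vs. interfering
  W_{ij}) and (A8) at Rx_k (dedicated W_{ki} vs. interfering W_{jk}).\<close>
definition exempt :: "nat \<Rightarrow> nat \<Rightarrow> nat \<Rightarrow> (nat \<times> nat \<times> nat \<times> nat) set" where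
  "exempt i j k = {(j, k, i, j), (k, i, j, k)}"

definition scheme :: "nat \<Rightarrow> channel \<Rightarrow> nat \<Rightarrow> nat \<Rightarrow> nat \<Rightarrow> offsets \<Rightarrow> bool" where
  "scheme n D i j k p \<longleftrightarrow> offsets_ok n p \<and> alignment n D i j k p \<and>
     sep_S1 n p \<and> sep_S2 n D p \<and> sep_S3_except n D p (exempt i j k)"

definition channel_conds :: "nat \<Rightarrow> channel \<Rightarrow> nat \<Rightarrow> nat \<Rightarrow> nat \<Rightarrow> bool" where
  "channel_conds n D i j k \<longleftrightarrow>
     \<comment> \<open>(i)\<close>
     [D i j + D k i + D j k = D j i + D i k + D k j] (mod n) \<and>
     \<comment> \<open>(ii)\<close>
     [D i i + D j k + D k j = D j j + D i k + D k i] (mod n) \<and>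
     [D j j + D i k + D k i = D k k + D i j + D j i] (mod n) \<and>
     \<comment> \<open>(iii)\<close>
     \<not> [D i i + D k k = D i k + D k i] (mod n) \<and>
     \<comment> \<open>(iv)\<close>
     \<not> [D i i + D j j = D i j + D j i] (mod n) \<and>
     \<comment> \<open>(v)\<close>
     \<not> [D i i + D j k = D i k + D j i] (mod n) \<and>
     \<comment> \<open>(vi)\<close>
     \<not> [D i j + D j k = D i k + D j j] (mod n) \<and>
     \<comment> \<open>(vii)\<close>
     \<not> [D k k + D j i = D k i + D j k] (mod n) \<and>
     \<comment> \<open>(viii)\<close>
     \<not> [D k k + D j j = D k j + D j k] (mod n) \<and>
     \<comment> \<open>(ix)\<close>
     \<not> [D i i + D j j + D k k = D i j + D j k + D k i] (mod n) \<and>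
     [D i j + D j k + D k i = D j i + D k j + D i k] (mod n) \<and>
     \<comment> \<open>(x)\<close>
     \<not> [D k k + D i i + D j j + D k k = D j k + D k j + D i k + D k i] (mod n) \<and>
     \<not> [D i i + D i i + D j j + D k k = D i j + D j i + D i k + D k i] (mod n) \<and>
     \<not> [D j j + D i i + D j j + D k k = D i j + D j i + D j k + D k j] (mod n)"

text \<open>T : set of messages (b, l) = W_{bl} actually transmitted over the channel
  (by Tx_l).  W_{al} is received interference-free at Rx_a if it is transmitted
  and its offset at Rx_a contains no other transmitted message.\<close>
definition interference_free :: "nat \<Rightarrow> channel \<Rightarrow> offsets \<Rightarrow> (nat \<times> nat) set \<Rightarrow> nat \<Rightarrow> nat \<Rightarrow> bool" where
  "interference_free n D p T a l \<longleftrightarrow> (a, l) \<in> T \<and>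
     (\<forall>(b, l') \<in> T. (b, l') \<noteq> (a, l) \<longrightarrow> \<not> [sig D p a l a = sig D p a l' b] (mod n))"

text \<open>B : set of messages (a, l) = W_{al} delivered over a rate-1 feedforward
  backhaul link from Tx_l to Rx_a (interference-free).  A message is obtained by
  its intended receiver if it comes over the backhaul or is received
  interference-free over the channel.\<close>
definition obtained :: "nat \<Rightarrow> channel \<Rightarrow> offsets \<Rightarrow> (nat \<times> nat) set \<Rightarrow> (nat \<times> nat) set \<Rightarrow> nat \<Rightarrow> nat \<Rightarrow> bool" where
  "obtained n D p T B a l \<longleftrightarrow> (a, l) \<in> B \<or> interference_free n D p T a l"

definition dof :: "nat \<Rightarrow> channel \<Rightarrow> offsets \<Rightarrow> (nat \<times> nat) set \<Rightarrow> (nat \<times> nat) set \<Rightarrow> real" where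
  "dof n D p T B = real (card {(a, l) \<in> Users \<times> Users. obtained n D p T B a l}) / real n"

definition theta_FF :: "(nat \<times> nat) set \<Rightarrow> nat" where
  "theta_FF B = card B"

end

theory Submission
  imports Defs
begin

text \<open>
Shifting all signals at a receiver, or all offsets of a transmitter, changes nothing essential.
Modulo these shifts the equations (i) and (ii) leave a single free parameter
\<open>c \<in> \<int>/5\<close>: with the row and column of user \<open>i\<close> normalised to \<open>0\<close>, the exponents of
\<open>d\<^sub>j\<^sub>j, d\<^sub>k\<^sub>k\<close> are \<open>c\<close> and those of \<open>d\<^sub>j\<^sub>k, d\<^sub>k\<^sub>j\<close> are \<open>3c\<close>. Every inequation
(iii)--(x) then reads \<open>m c \<noteq> 0\<close> with \<open>m\<close> prime to 5. The alignment equations force the same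
shape, with offsets that are fixed multiples of \<open>c\<close> up to shifts, and all separability
conditions again become \<open>m c \<noteq> 0\<close>.

Without backhaul, the three dedicated signals at each receiver leave two slots, so any two
transmitters place their two interfering messages there either in the same or in swapped order.
Same order at two receivers makes two dedicated signals collide at each of them; same order at
exactly one forces two offsets of a transmitter to agree, because the offset differences sum to
zero. So any two of the three transmitters are in swapped order at every receiver, which is
impossible for three transmitters and two orders.
\<close>

section \<open>Normal form of the channels that admit the scheme\<close>

definition profile_D :: "nat \<Rightarrow> nat \<Rightarrow> nat \<Rightarrow> int" where
  "profile_D i a l = (if a = i \<or> l = i then 0 else if a = l then 1 else 3)"

text \<open>The solution of (A1)-(A8) modulo 5 for the channel \<open>profile_D i\<close>, unique
  once \<open>W_{ii}\<close> has offset 0.\<close>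

definition profile_p :: "nat \<Rightarrow> nat \<Rightarrow> nat \<Rightarrow> nat \<Rightarrow> int" where
  "profile_p i j b l =
     (if b = i then (if l = i then 0 else if l = j then 3 else 4)
      else if (b = j) = (l = j) then 2 else 1)"

definition normal_form_channel :: "channel \<Rightarrow> nat \<Rightarrow> bool" where
  "normal_form_channel D i \<longleftrightarrow> (\<exists>r t c. \<not> 5 dvd c \<and>
     (\<forall>a\<in>Users. \<forall>l\<in>Users. [int (D a l) = r a + t l + c * profile_D i a l] (mod 5)))"

lemma Users_eq:
  assumes "i \<in> Users" "j \<in> Users" "k \<in> Users" "i \<noteq> j" "j \<noteq> k" "i \<noteq> k"
  shows "Users = {i, j, k}"
  using assms by (auto simp: Users_def)

lemma cong_nat_iff_dvd: "[x = y] (mod 5) \<longleftrightarrow> (5::int) dvd int x - int y" for x y :: nat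
  by (metis cong_iff_dvd_diff cong_int_iff of_nat_numeral)

lemma five_dvd_mult_iff: "\<not> 5 dvd c \<Longrightarrow> 5 dvd c * m \<longleftrightarrow> 5 dvd m" for c m :: int
  by (simp add: prime_dvd_mult_iff)

text \<open>The shifts \<open>r\<close> and \<open>t\<close> are read off column and row
  \<open>i\<close>; \<open>a\<close> is what they leave in entry \<open>(j, j)\<close> and becomes
  the parameter \<open>c\<close>.\<close>

lemma normal_form_channelI:
  assumes U: "Users = {i, j, k}" and d: "i \<noteq> j" "j \<noteq> k" "i \<noteq> k"
    and a: "a = int (D j j) + int (D i i) - int (D i j) - int (D j i)" "\<not> 5 dvd a"
    and e: "5 dvd int (D j k) + int (D i i) - int (D i k) - int (D j i) - 3 * a"
      "5 dvd int (D k j) + int (D i i) - int (D i j) - int (D k i) - 3 * a"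
      "5 dvd int (D k k) + int (D i i) - int (D i k) - int (D k i) - a"
  shows "normal_form_channel D i"
  unfolding normal_form_channel_def
  by (intro exI[of _ "\<lambda>a. int (D a i)"] exI[of _ "\<lambda>l. int (D i l) - int (D i i)"] exI[of _ a])
    (use d a e in \<open>auto simp: U profile_D_def cong_iff_dvd_diff algebra_simps\<close>)

lemma channel_conds_iff_normal_form:
  assumes U: "Users = {i, j, k}" and d: "i \<noteq> j" "j \<noteq> k" "i \<noteq> k"
  shows "channel_conds 5 D i j k \<longleftrightarrow> normal_form_channel D i"
proof
  assume C: "channel_conds 5 D i j k"
  define a where "a = int (D j j) + int (D i i) - int (D i j) - int (D j i)"
  define b where "b = int (D j k) + int (D i i) - int (D i k) - int (D j i)"
  define e where "e = int (D k j) + int (D i i) - int (D i j) - int (D k i)"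
  define f where "f = int (D k k) + int (D i i) - int (D i k) - int (D k i)"
  \<comment> \<open>These are (i), both halves of (ii), and (iv), in terms of combinations that no
    shift changes.\<close>
  have "5 dvd b - e" "5 dvd b + e - a" "5 dvd a - f" "\<not> 5 dvd a"
    using C unfolding channel_conds_def cong_nat_iff_dvd a_def b_def e_def f_def
    by (simp_all add: algebra_simps)
  \<comment> \<open>Modulo 5, \<open>b\<close> and \<open>e\<close> agree and add up to
    \<open>a\<close>; as 3 is the inverse of 2, each is \<open>3 * a\<close>.\<close>
  then have "5 dvd b - 3 * a" "5 dvd e - 3 * a" "5 dvd f - a"
    by presburger+
  with \<open>\<not> 5 dvd a\<close> show "normal_form_channel D i"
    by (intro normal_form_channelI[OF U d a_def]) (auto simp: b_def e_def f_def)
next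
  assume "normal_form_channel D i"
  then obtain r t c where c: "\<not> 5 dvd c"
    and D: "\<forall>a\<in>Users. \<forall>l\<in>Users. [int (D a l) = r a + t l + c * profile_D i a l] (mod 5)"
    unfolding normal_form_channel_def by blast
  then have "\<forall>a\<in>Users. \<forall>l\<in>Users. \<exists>q. int (D a l) = r a + t l + c * profile_D i a l + 5 * q"
    by (metis cong_iff_lin cong_sym)
  then obtain q where q: "\<And>a l. a \<in> Users \<Longrightarrow> l \<in> Users \<Longrightarrow>
      int (D a l) = r a + t l + c * profile_D i a l + 5 * q a l"
    by metis
  have D':
    "int (D i i) = r i + t i + 5 * q i i" "int (D i j) = r i + t j + 5 * q i j"
    "int (D i k) = r i + t k + 5 * q i k" "int (D j i) = r j + t i + 5 * q j i"
    "int (D j j) = r j + t j + c + 5 * q j j" "int (D j k) = r j + t k + c * 3 + 5 * q j k"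
    "int (D k i) = r k + t i + 5 * q k i" "int (D k j) = r k + t j + c * 3 + 5 * q k j"
    "int (D k k) = r k + t k + c + 5 * q k k"
    using d by (simp_all add: q U profile_D_def)
  show "channel_conds 5 D i j k"
    unfolding channel_conds_def cong_nat_iff_dvd of_nat_add D'
    using c by presburger
qed

lemma scheme_imp_normal_form:
  assumes U: "Users = {i, j, k}" and d: "i \<noteq> j" "j \<noteq> k" "i \<noteq> k"
    and S: "scheme 5 D i j k p"
  shows "normal_form_channel D i"
proof -
  have A: "alignment 5 D i j k p" and "sep_S1 5 p"
    using S by (simp_all add: scheme_def)
  then have ne: "\<not> 5 dvd int (p i i) - int (p j i)"
    using d by (simp add: sep_S1_def U cong_nat_iff_dvd)
  define a where "a = int (D j j) + int (D i i) - int (D i j) - int (D j i)"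
  define b where "b = int (D j k) + int (D i i) - int (D i k) - int (D j i)"
  define e where "e = int (D k j) + int (D i i) - int (D i j) - int (D k i)"
  define f where "f = int (D k k) + int (D i i) - int (D i k) - int (D k i)"
  have A': "5 dvd int (sig D p i i j) - int (sig D p i j k)" (is "5 dvd ?e1")
    "5 dvd int (sig D p i j k) - int (sig D p i k j)" (is "5 dvd ?e2")
    "5 dvd int (sig D p i i k) - int (sig D p i j j)" (is "5 dvd ?e3")
    "5 dvd int (sig D p i j j) - int (sig D p i k k)" (is "5 dvd ?e4")
    "5 dvd int (sig D p j i k) - int (sig D p j j k)" (is "5 dvd ?e5")
    "5 dvd int (sig D p j i i) - int (sig D p j k k)" (is "5 dvd ?e7")
    "5 dvd int (sig D p j j i) - int (sig D p j k j)" (is "5 dvd ?e8")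
    "5 dvd int (sig D p k i i) - int (sig D p k j j)" (is "5 dvd ?e9")
    "5 dvd int (sig D p k j i) - int (sig D p k i j)" (is "5 dvd ?e11")
    "5 dvd int (sig D p k i k) - int (sig D p k k j)" (is "5 dvd ?e12")
    using A unfolding alignment_def cong_nat_iff_dvd by blast+
  \<comment> \<open>cycles in the graph whose vertices are the messages and whose edges are the alignments\<close>
  have "b - e = ?e9 - ?e7 + ?e4" "f - a = ?e5 - ?e12 + ?e2" "a - b - e = ?e8 - ?e11 - ?e1 - ?e2"
    "int (p i i) - int (p j i) - a - b = ?e7 - ?e3 - ?e4 + ?e5 - ?e1"
    by (simp_all add: sig_def a_def b_def e_def f_def)
  then have "5 dvd b - e" "5 dvd f - a" "5 dvd a - b - e" "5 dvd int (p i i) - int (p j i) - a - b"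
    using A' by (metis dvd_add dvd_diff)+
  \<comment> \<open>The offset difference is congruent to \<open>a + b\<close>, hence to
    \<open>4 * a\<close>, and (S1) makes it nonzero.\<close>
  then have "5 dvd b - 3 * a" "5 dvd e - 3 * a" "5 dvd f - a" "\<not> 5 dvd a"
    using ne by presburger+
  then show "normal_form_channel D i"
    by (intro normal_form_channelI[OF U d a_def]) (auto simp: b_def e_def f_def)
qed

lemma normal_form_imp_scheme:
  assumes U: "Users = {i, j, k}" and d: "i \<noteq> j" "j \<noteq> k" "i \<noteq> k"
    and R: "normal_form_channel D i"
  shows "\<exists>p. scheme 5 D i j k p"
proof -
  obtain r t c where c: "\<not> 5 dvd c"
    and D: "\<And>a l. a \<in> Users \<Longrightarrow> l \<in> Users \<Longrightarrow>
      [int (D a l) = r a + t l + c * profile_D i a l] (mod 5)"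
    using R unfolding normal_form_channel_def by blast
  \<comment> \<open>Here \<open>- t l\<close> undoes the transmitter shift. As \<open>r a\<close> is
    common to all signals at receiver \<open>a\<close> and \<open>c\<close> is a unit modulo 5,
    comparing signals reduces to comparing profiles.\<close>
  define p where "p b l = nat ((c * profile_p i j b l - t l) mod 5)" for b l
  have p: "[int (p b l) = c * profile_p i j b l - t l] (mod 5)" for b l
    by (simp add: p_def cong_def)
  have sig: "[int (sig D p a l b) = r a + c * (profile_D i a l + profile_p i j b l)] (mod 5)"
    if "a \<in> Users" "l \<in> Users" for a l b
    using cong_add[OF D[OF that] p[of b l]] by (simp add: sig_def algebra_simps)
  have sig_iff: "[sig D p a l b = sig D p a l' b'] (mod 5) \<longleftrightarrow>
      5 dvd profile_D i a l + profile_p i j b l - (profile_D i a l' + profile_p i j b' l')"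
    if "a \<in> Users" "l \<in> Users" "l' \<in> Users" for a l b l' b'
  proof -
    have "[sig D p a l b = sig D p a l' b'] (mod 5) \<longleftrightarrow>
      [int (sig D p a l b) = int (sig D p a l' b')] (mod 5)"
      using cong_int_iff[of _ _ 5] by simp
    also have "\<dots> \<longleftrightarrow> 5 dvd c * (profile_D i a l + profile_p i j b l -
        (profile_D i a l' + profile_p i j b' l'))"
      unfolding cong_def sig[OF that(1,2), of b, unfolded cong_def]
        sig[OF that(1,3), of b', unfolded cong_def]
      by (simp add: mod_eq_dvd_iff right_diff_distrib)
    finally show ?thesis by (simp add: five_dvd_mult_iff[OF c])
  qed
  have p_iff: "[p a l = p b l] (mod 5) \<longleftrightarrow> 5 dvd profile_p i j a l - profile_p i j b l" for a b l
  proof -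
    have "[p a l = p b l] (mod 5) \<longleftrightarrow> [int (p a l) = int (p b l)] (mod 5)"
      using cong_int_iff[of _ _ 5] by simp
    also have "\<dots> \<longleftrightarrow> 5 dvd c * (profile_p i j a l - profile_p i j b l)"
      unfolding cong_def p[unfolded cong_def] by (simp add: mod_eq_dvd_iff right_diff_distrib)
    finally show ?thesis by (simp add: five_dvd_mult_iff[OF c])
  qed
  have "offsets_ok 5 p"
    by (auto simp: offsets_ok_def p_def)
  moreover have "alignment 5 D i j k p"
    unfolding alignment_def using d
    by (simp add: sig_iff U) (simp add: profile_D_def profile_p_def)
  moreover have "sep_S1 5 p"
    unfolding sep_S1_def p_iff using d by (simp add: U profile_p_def)
  moreover have "sep_S2 5 D p"
    unfolding sep_S2_def using d
    by (simp add: sig_iff U) (simp add: profile_D_def profile_p_def)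
  moreover have "sep_S3_except 5 D p (exempt i j k)"
    unfolding sep_S3_except_def exempt_def using d
    by (simp add: sig_iff U) (simp add: profile_D_def profile_p_def)
  ultimately show ?thesis
    unfolding scheme_def by blast
qed

section \<open>Achievability with one backhaul message\<close>

lemma scheme_obtained:
  assumes S: "scheme n D i j k p"
    and "a \<in> Users" "l \<in> Users"
  shows "obtained n D p (Users \<times> Users - {(j, k)}) {(j, k)} a l"
proof (cases "(a, l) = (j, k)")
  case False
  have "\<not> [sig D p a l a = sig D p a l' b] (mod n)"
    if "b \<in> Users" "l' \<in> Users" "(b, l') \<noteq> (j, k)" "(b, l') \<noteq> (a, l)" for b l'
  proof (cases "b = a")
    case True
    then show ?thesis
      using S that assms(2,3) by (auto simp: scheme_def sep_S2_def)
  next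
    case ne: False
    \<comment> \<open>Both exempted collisions involve \<open>W_{jk}\<close>, once as dedicated and
      once as interfering message, so taking it off the channel clears them.\<close>
    have "(a, l, b, l') \<notin> exempt i j k"
      using False that by (auto simp: exempt_def)
    with ne show ?thesis
      using S that assms(2,3) unfolding scheme_def sep_S3_except_def by blast
  qed
  then show ?thesis
    using False assms(2,3) by (auto simp: obtained_def interference_free_def)
qed (simp add: obtained_def)

section \<open>Necessity of backhaul\<close>

lemma doubleton_eq_in_five:
  fixes x y z u v u' v' :: nat
  assumes "{x, y, z, u, v, u', v'} \<subseteq> {..<5}"
    and "x \<noteq> y" "x \<noteq> z" "y \<noteq> z" "u \<noteq> v" "u' \<noteq> v'"
    and "{u, v, u', v'} \<inter> {x, y, z} = {}"
  shows "u = u' \<and> v = v' \<or> u = v' \<and> v = u'"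
proof -
  have c: "card ({..<5} - {x, y, z}) = 2"
    using assms by (subst card_Diff_subset) auto
  have "{u, v} = {..<5} - {x, y, z}" "{u', v'} = {..<5} - {x, y, z}"
    by (rule card_subset_eq; use assms c in auto)+
  then show ?thesis
    by (metis doubleton_eq_iff)
qed

lemma offsets_distinct_if_interference_free:
  assumes "interference_free n D p T a l" and "(b, l) \<in> T" and "b \<noteq> a"
  shows "\<not> [p a l = p b l] (mod n)"
proof
  assume "[p a l = p b l] (mod n)"
  then have "[sig D p a l a = sig D p a l b] (mod n)"
    unfolding sig_def by (intro cong_add cong_refl)
  with assms show False
    by (auto simp: interference_free_def)
qed

lemma interference_aligned:
  assumes IF: "\<And>a l. a \<in> Users \<Longrightarrow> l \<in> Users \<Longrightarrow> interference_free 5 D p (Users \<times> Users) a l"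
    and U: "Users = {a, b, c}" and d: "a \<noteq> b" "b \<noteq> c" "a \<noteq> c"
    and l: "l \<in> Users" "l' \<in> Users"
  shows "[sig D p a l b = sig D p a l' b] (mod 5) \<and> [sig D p a l c = sig D p a l' c] (mod 5) \<or>
    [sig D p a l b = sig D p a l' c] (mod 5) \<and> [sig D p a l c = sig D p a l' b] (mod 5)"
proof -
  have sep: "\<not> [sig D p x m x = sig D p x m' y] (mod 5)"
    if "x \<in> Users" "m \<in> Users" "y \<in> Users" "m' \<in> Users" "(y, m') \<noteq> (x, m)" for x y m m'
    using IF[of x m] that by (auto simp: interference_free_def)
  \<comment> \<open>Both messages pass through the same coefficient, so a collision here would recur
    at receiver \<open>b\<close>, where one of them is dedicated.\<close>
  have same_tx: "\<not> [sig D p a m b = sig D p a m c] (mod 5)" if "m \<in> Users" for m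
    using offsets_distinct_if_interference_free[OF IF[of b m], of c] that d
    by (simp add: sig_def U cong_add_lcancel_nat)
  show ?thesis
    unfolding cong_def
    by (rule doubleton_eq_in_five[of "sig D p a a a mod 5" "sig D p a b a mod 5"
          "sig D p a c a mod 5"])
      (use sep[of a] same_tx l d in \<open>auto simp: U cong_def\<close>)
qed

text \<open>For two transmitters, \<open>x\<^sub>b\<close> and \<open>y\<^sub>b\<close> are their offsets for receiver \<open>b\<close>, and \<open>e\<^sub>a\<close> is the
  difference of their channel exponents to receiver \<open>a\<close>.\<close>

lemma swapped_of_aligned:
  fixes e1 e2 e3 x1 x2 x3 y1 y2 y3 :: int
  assumes "5 dvd e1 + x2 - y2 \<and> 5 dvd e1 + x3 - y3 \<or> 5 dvd e1 + x2 - y3 \<and> 5 dvd e1 + x3 - y2"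
    and "5 dvd e2 + x1 - y1 \<and> 5 dvd e2 + x3 - y3 \<or> 5 dvd e2 + x1 - y3 \<and> 5 dvd e2 + x3 - y1"
    and "5 dvd e3 + x1 - y1 \<and> 5 dvd e3 + x2 - y2 \<or> 5 dvd e3 + x1 - y2 \<and> 5 dvd e3 + x2 - y1"
    and "\<not> 5 dvd e1 + x1 - y1" and "\<not> 5 dvd x2 - x3"
  shows "5 dvd (x2 - x3) + (y2 - y3)"
proof (cases "5 dvd e1 + x2 - y3 \<and> 5 dvd e1 + x3 - y2")
  case True
  then have "5 dvd (e1 + x2 - y3) - (e1 + x3 - y2)"
    by (blast intro: dvd_diff)
  then show ?thesis by (simp add: algebra_simps)
next
  case False
  then have m: "5 dvd e1 + x2 - y2" "5 dvd e1 + x3 - y3"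
    using assms(1) by auto
  \<comment> \<open>Same order at receivers 1 and 2 would match \<open>x3\<close> with
    \<open>y3\<close> at both, so \<open>e1\<close> and \<open>e2\<close> would agree and the
    dedicated signals at receiver 1 collide.\<close>
  have "\<not> (5 dvd e2 + x1 - y1 \<and> 5 dvd e2 + x3 - y3)"
    using dvd_add[OF dvd_diff[OF m(2)], of "e2 + x3 - y3" "e2 + x1 - y1"] assms(4)
    by (auto simp: algebra_simps)
  then have s2: "5 dvd e2 + x1 - y3" "5 dvd e2 + x3 - y1"
    using assms(2) by auto
  have "\<not> (5 dvd e3 + x1 - y1 \<and> 5 dvd e3 + x2 - y2)"
    using dvd_add[OF dvd_diff[OF m(1)], of "e3 + x2 - y2" "e3 + x1 - y1"] assms(4)
    by (auto simp: algebra_simps)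
  then have s3: "5 dvd e3 + x1 - y2" "5 dvd e3 + x2 - y1"
    using assms(3) by auto
  \<comment> \<open>Swapped order negates an offset difference between the transmitters, same order
    preserves it; in this combination all \<open>y\<close> terms cancel.\<close>
  have "5 dvd ((e2 + x1 - y3) - (e2 + x3 - y1)) - ((e3 + x1 - y2) - (e3 + x2 - y1)) +
      ((e1 + x2 - y2) - (e1 + x3 - y3))"
    by (rule dvd_add[OF dvd_diff[OF dvd_diff[OF s2] dvd_diff[OF s3]] dvd_diff[OF m]])
  also have "\<dots> = 2 * (x2 - x3)" by simp
  finally have "5 dvd x2 - x3" by presburger
  with assms(5) show ?thesis by contradiction
qed

lemma not_all_interference_free:
  "\<exists>a\<in>Users. \<exists>l\<in>Users. \<not> interference_free 5 D p (Users \<times> Users) a l"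
proof (rule ccontr)
  assume "\<not> ?thesis"
  then have IF: "\<And>a l. a \<in> Users \<Longrightarrow> l \<in> Users \<Longrightarrow> interference_free 5 D p (Users \<times> Users) a l"
    by blast
  have swap: "5 dvd (int (p 2 l) - int (p 3 l)) + (int (p 2 l') - int (p 3 l'))"
    if l: "l \<in> Users" "l' \<in> Users" "l \<noteq> l'" for l l'
  proof -
    have ded: "\<not> [sig D p a l a = sig D p a l' a] (mod 5)" if "a \<in> Users" for a
      using IF[of a l] that l by (auto simp: interference_free_def)
    note al = interference_aligned[OF IF _ _ _ _ l(1,2)]
    define e where "e a = int (D a l) - int (D a l')" for a
    define x where "x a = int (p a l)" for a
    define y where "y a = int (p a l')" for a
    have dd: "[sig D p a l b = sig D p a l' b'] (mod 5) \<longleftrightarrow> 5 dvd e a + x b - y b'" for a b b'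
      by (simp add: cong_nat_iff_dvd sig_def e_def x_def y_def algebra_simps)
    have "5 dvd e 1 + x 2 - y 2 \<and> 5 dvd e 1 + x 3 - y 3 \<or>
        5 dvd e 1 + x 2 - y 3 \<and> 5 dvd e 1 + x 3 - y 2"
      "5 dvd e 2 + x 1 - y 1 \<and> 5 dvd e 2 + x 3 - y 3 \<or>
        5 dvd e 2 + x 1 - y 3 \<and> 5 dvd e 2 + x 3 - y 1"
      "5 dvd e 3 + x 1 - y 1 \<and> 5 dvd e 3 + x 2 - y 2 \<or>
        5 dvd e 3 + x 1 - y 2 \<and> 5 dvd e 3 + x 2 - y 1"
      using al[of 1 2 3] al[of 2 1 3] al[of 3 1 2] by (auto simp: Users_def dd)
    moreover have "\<not> 5 dvd e 1 + x 1 - y 1"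
      using ded by (simp add: Users_def dd)
    moreover have "\<not> 5 dvd x 2 - x 3"
      using offsets_distinct_if_interference_free[OF IF[of 2 l], of 3] l(1)
      by (simp add: Users_def cong_nat_iff_dvd x_def)
    ultimately have "5 dvd (x 2 - x 3) + (y 2 - y 3)"
      by (intro swapped_of_aligned[of "e 1" "x 2" "y 2" "x 3" "y 3" "e 2" "x 1" "y 1" "e 3"])
    then show ?thesis by (simp add: x_def y_def)
  qed
  have "\<not> 5 dvd int (p 2 1) - int (p 3 1)"
    using offsets_distinct_if_interference_free[OF IF[of 2 1], of 3]
    by (simp add: Users_def cong_nat_iff_dvd)
  \<comment> \<open>Three residues with pairwise sums 0 all vanish, because 2 is a unit modulo
    5.\<close>
  moreover have "5 dvd (int (p 2 1) - int (p 3 1)) + (int (p 2 2) - int (p 3 2))"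
    "5 dvd (int (p 2 2) - int (p 3 2)) + (int (p 2 3) - int (p 3 3))"
    "5 dvd (int (p 2 1) - int (p 3 1)) + (int (p 2 3) - int (p 3 3))"
    by (rule swap; simp add: Users_def)+
  ultimately show False
    by presburger
qed

theorem theorem2:
  fixes D :: channel and i j k :: nat
  assumes "i \<in> Users" and "j \<in> Users" and "k \<in> Users"
    and "i \<noteq> j" and "j \<noteq> k" and "i \<noteq> k"
  shows
    \<comment> \<open>(1)\<close>
    "((\<exists>p. scheme 5 D i j k p) \<longleftrightarrow> channel_conds 5 D i j k)
     \<comment> \<open>(2)\<close>
     \<and> (channel_conds 5 D i j k \<longrightarrow>
          (\<forall>p. scheme 5 D i j k p \<longrightarrow>
             (\<forall>a\<in>Users. \<forall>l\<in>Users.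
                 obtained 5 D p (Users \<times> Users - {(j, k)}) {(j, k)} a l)
             \<and> dof 5 D p (Users \<times> Users - {(j, k)}) {(j, k)} = 9 / 5
             \<and> theta_FF {(j, k)} = 1))
     \<comment> \<open>(3)\<close>
     \<and> (\<forall>p T B. offsets_ok 5 p \<longrightarrow> T \<subseteq> Users \<times> Users \<longrightarrow> B \<subseteq> Users \<times> Users \<longrightarrow>
          dof 5 D p T B = 9 / 5 \<longrightarrow> theta_FF B \<ge> 1)"
proof (intro conjI impI allI)
  note U = Users_eq[OF assms]
  show "(\<exists>p. scheme 5 D i j k p) \<longleftrightarrow> channel_conds 5 D i j k"
    using channel_conds_iff_normal_form[OF U assms(4-6)] scheme_imp_normal_form[OF U assms(4-6)]
      normal_form_imp_scheme[OF U assms(4-6)] by blast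
  fix p
  assume S: "scheme 5 D i j k p"
  show "\<forall>a\<in>Users. \<forall>l\<in>Users. obtained 5 D p (Users \<times> Users - {(j, k)}) {(j, k)} a l"
    using scheme_obtained[OF S] by blast
  then have "{(a, l) \<in> Users \<times> Users. obtained 5 D p (Users \<times> Users - {(j, k)}) {(j, k)} a l} =
      Users \<times> Users"
    by auto
  then show "dof 5 D p (Users \<times> Users - {(j, k)}) {(j, k)} = 9 / 5"
    by (simp add: dof_def card_cartesian_product) (simp add: Users_def)
  show "theta_FF {(j, k)} = 1"
    by (simp add: theta_FF_def)
next
  fix p T B
  assume T: "T \<subseteq> Users \<times> Users" and B: "B \<subseteq> Users \<times> Users" and dof: "dof 5 D p T B = 9 / 5"
  have fin: "finite (Users \<times> Users)" and card: "card (Users \<times> Users) = 9"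
    by (simp_all add: Users_def card_cartesian_product)
  have "{(a, l) \<in> Users \<times> Users. obtained 5 D p T B a l} = Users \<times> Users"
    by (rule card_subset_eq[OF fin]) (use dof in \<open>auto simp: dof_def card\<close>)
  then have obt: "obtained 5 D p T B a l" if "a \<in> Users" "l \<in> Users" for a l
    using that by blast
  have "B \<noteq> {}"
  proof
    assume "B = {}"
    with obt have IF: "interference_free 5 D p T a l" if "a \<in> Users" "l \<in> Users" for a l
      using that by (auto simp: obtained_def)
    \<comment> \<open>Only transmitted messages can be interference-free, so all nine are on the
      channel.\<close>
    then have "T = Users \<times> Users"
      using T by (auto simp: interference_free_def)
    with IF show False
      using not_all_interference_free by blast
  qed
  then show "theta_FF B \<ge> 1"
    using finite_subset[OF B fin] by (simp add: theta_FF_def Suc_le_eq card_gt_0_iff)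
qed

end
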